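(* Let $n$ be a positive integer, let $\mathcal{A}$ and $\mathcal{B}$ be unital Banach algebras such that $\mathcal{B}$ is a right $\mathcal{A}$-module, and let $\varphi:\mathcal{A}\to\mathcal{B}$ be a unital pseudo $(n+1)$-Jordan homomorphism with a Jordan coefficient $w$. Then $\varphi$ is a pseudo $n$-Jordan homomorphism.
   Context: Banach algebras are complex and associative. For a positive integer $m$ and $\mathcal{B}$ a right $\mathcal{A}$-module (action written $b\cdot a$), a linear map $\varphi:\mathcal{A}\to\mathcal{B}$ is called a pseudo $m$-Jordan homomorphism if there exists an element $w\in\mathcal{A}$ such that $\varphi(a^m w)=\varphi(a)^m\cdot w$ for all $a\in\mathcal{A}$; such an element $w$ is called a Jordan coefficient of $\varphi$. The map $\varphi$ is unital if $\varphi(e)=e'$, where $e$ and $e'$ are the unit elements of $\mathcal{A}$ and $\mathcal{B}$, respectively. *)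

theory Defs
  imports Complex_Main
begin

class scaleC =
  fixes scaleC :: "complex \<Rightarrow> 'a \<Rightarrow> 'a"  (infixr "*\<^sub>C" 75)

class complex_vector = scaleC + ab_group_add +
  assumes scaleC_add_right: "c *\<^sub>C (x + y) = c *\<^sub>C x + c *\<^sub>C y"
    and scaleC_add_left: "(c + d) *\<^sub>C x = c *\<^sub>C x + d *\<^sub>C x"
    and scaleC_scaleC: "c *\<^sub>C (d *\<^sub>C x) = (c * d) *\<^sub>C x"
    and scaleC_one: "1 *\<^sub>C x = x"

text \<open>
  The library only has real Banach algebras. The class below adds a complex structure that extends
  the real one and is compatible with product and norm. Completeness comes from \<^class>\<open>banach\<close>, and
  submultiplicativity of the norm from \<^class>\<open>real_normed_algebra\<close>. The unit comes from
  \<^class>\<open>monoid_mult\<close> rather than from \<^class>\<open>real_normed_algebra_1\<close>, so neither that the unit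
  has norm one nor that the algebra is nonzero is assumed.
\<close>

class complex_unital_banach_algebra =
  complex_vector + real_normed_algebra + banach + monoid_mult +
  assumes scaleR_scaleC: "r *\<^sub>R x = complex_of_real r *\<^sub>C x"
    and norm_scaleC: "norm (c *\<^sub>C x) = cmod c * norm x"
    and mult_scaleC_left: "(c *\<^sub>C x) * y = c *\<^sub>C (x * y)"
    and mult_scaleC_right: "x * (c *\<^sub>C y) = c *\<^sub>C (x * y)"

instantiation complex :: complex_unital_banach_algebra
begin

definition scaleC_complex :: "complex \<Rightarrow> complex \<Rightarrow> complex" where
  "scaleC_complex c x = c * x"

instance
  by standard (simp_all add: scaleC_complex_def algebra_simps norm_mult scaleR_conv_of_real)

end

abbreviation clinear :: "('a::complex_vector \<Rightarrow> 'b::complex_vector) \<Rightarrow> bool" where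
  "clinear \<equiv> Vector_Spaces.linear scaleC scaleC"

text \<open>
  Right modules over an algebra in the purely algebraic sense: the action is bilinear and
  associative. Neither continuity of the action nor \<open>b \<cdot> 1 = b\<close> is required, and no compatibility
  with a product on the module is required when it happens to be an algebra itself.
\<close>

locale right_module =
  fixes act :: "'b::complex_vector \<Rightarrow> 'a::complex_unital_banach_algebra \<Rightarrow> 'b"  (infixl "\<cdot>" 70)
  assumes act_linear_left: "clinear (\<lambda>b. b \<cdot> a)"
    and act_linear_right: "clinear (\<lambda>a. b \<cdot> a)"
    and act_act: "(b \<cdot> a) \<cdot> a' = b \<cdot> (a * a')"

definition jordan_coefficient ::
  "('b \<Rightarrow> 'a \<Rightarrow> 'b) \<Rightarrow> nat
    \<Rightarrow> ('a::complex_unital_banach_algebra \<Rightarrow> 'b::complex_unital_banach_algebra) \<Rightarrow> 'a \<Rightarrow> bool"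
  where "jordan_coefficient act m \<phi> w \<longleftrightarrow> (\<forall>a. \<phi> (a ^ m * w) = act (\<phi> a ^ m) w)"

definition pseudo_jordan_homomorphism ::
  "('b \<Rightarrow> 'a \<Rightarrow> 'b) \<Rightarrow> nat
    \<Rightarrow> ('a::complex_unital_banach_algebra \<Rightarrow> 'b::complex_unital_banach_algebra) \<Rightarrow> bool"
  where "pseudo_jordan_homomorphism act m \<phi> \<longleftrightarrow>
    clinear \<phi> \<and> (\<exists>w. jordan_coefficient act m \<phi> w)"

end

theory Submission
  imports Defs
begin

text \<open>
  The idea is to polarise the Jordan identity in the direction of the unit. Put \<open>m = n + 1\<close> and
  replace \<open>a\<close> by \<open>a + t 1\<close> with a real parameter \<open>t\<close>. Since \<open>t 1\<close> commutes with everything and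
  \<open>\<phi> (a + t 1) = \<phi> a + t 1\<close>, the binomial theorem turns both sides of
  \<open>\<phi> ((a + t 1)\<^sup>m w) = (\<phi> a + t 1)\<^sup>m \<cdot> w\<close> into polynomials in \<open>t\<close>; the coefficients of \<open>t\<^sup>j\<close> are
  \<open>(m choose j) \<phi> (a\<^bsup>m - j\<^esup> w)\<close> and \<open>(m choose j) (\<phi> a)\<^bsup>m - j\<^esup> \<cdot> w\<close>. Vector-valued polynomials that
  agree for all \<open>t\<close> have equal coefficients, and the binomial coefficients are nonzero, so \<open>w\<close> is a
  Jordan coefficient for every exponent up to \<open>m\<close>. The case \<open>j = 1\<close> is the theorem.
\<close>

lemma clinear_imp_linear:
  fixes f :: "'a::complex_unital_banach_algebra \<Rightarrow> 'b::complex_unital_banach_algebra"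
  assumes "clinear f"
  shows "linear f"
proof -
  interpret f: Vector_Spaces.linear scaleC scaleC f by (rule assms)
  show ?thesis
    by (rule linearI) (simp_all add: f.add f.scale scaleR_scaleC)
qed

text \<open>
  The element \<open>t 1\<close> is central, so the usual Pascal induction works without commutativity of the
  algebra. The binomial coefficients act as scalars rather than as elements of the algebra,
  so that the zero algebra is covered as well.
\<close>

lemma binomial_add_scaleR_one:
  fixes a :: "'a::{real_algebra, monoid_mult}"
  shows "(a + t *\<^sub>R 1) ^ m = (\<Sum>k\<le>m. (real (m choose k) * t ^ k) *\<^sub>R a ^ (m - k))"
proof (induction m)
  case 0
  show ?case by simp
next
  case (Suc m)
  define f where "f k = (real (m choose k) * t ^ k) *\<^sub>R a ^ (Suc m - k)" for k
  define g where "g k = (real (m choose k) * t ^ Suc k) *\<^sub>R a ^ (m - k)" for k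
  have "(a + t *\<^sub>R 1) ^ Suc m =
      (a + t *\<^sub>R 1) * (\<Sum>k\<le>m. (real (m choose k) * t ^ k) *\<^sub>R a ^ (m - k))"
    by (simp add: Suc.IH)
  also have "\<dots> = (\<Sum>k\<le>m. f k) + (\<Sum>k\<le>m. g k)"
    unfolding distrib_right sum_distrib_left sum.distrib
    by (intro arg_cong2[where f = "(+)"] sum.cong)
      (auto simp: f_def g_def Suc_diff_le mult_ac)
  \<comment> \<open>the added summand carries the factor \<open>m choose Suc m = 0\<close>\<close>
  also have "(\<Sum>k\<le>m. f k) = (\<Sum>k\<le>Suc m. f k)"
    by (simp add: f_def)
  also have "\<dots> = f 0 + (\<Sum>k\<le>m. f (Suc k))"
    by (rule sum.atMost_Suc_shift)
  also have "f 0 + (\<Sum>k\<le>m. f (Suc k)) + (\<Sum>k\<le>m. g k) =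
      f 0 + (\<Sum>k\<le>m. f (Suc k) + g k)"
    by (simp add: sum.distrib)
  also have "\<dots> = (\<Sum>k\<le>Suc m. (real (Suc m choose k) * t ^ k) *\<^sub>R a ^ (Suc m - k))"
    unfolding sum.atMost_Suc_shift
    by (simp add: f_def g_def algebra_simps)
  finally show ?case .
qed

text \<open>
  If \<open>p\<close> is a polynomial of degree at most \<open>m\<close> that vanishes for all \<open>t\<close>, then so does
  \<open>p (2 t) - 2\<^sup>m p t\<close>. There the term of degree \<open>m\<close> cancels, while the coefficient of degree
  \<open>k < m\<close> is multiplied by \<open>2\<^sup>k - 2\<^sup>m \<noteq> 0\<close>, so induction on the degree applies.
\<close>

lemma vector_polynomial_eq_0_imp_coeffs_eq_0:
  fixes c :: "nat \<Rightarrow> 'a::real_vector"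
  assumes "\<And>t::real. (\<Sum>k\<le>m. t ^ k *\<^sub>R c k) = 0" and "k \<le> m"
  shows "c k = 0"
  using assms
proof (induction m arbitrary: c k)
  case 0
  then show ?case using "0.prems"(1)[of 1] by simp
next
  case (Suc m)
  define d where "d j = ((2::real) ^ j - 2 ^ Suc m) *\<^sub>R c j" for j
  have d_sum: "(\<Sum>j\<le>m. t ^ j *\<^sub>R d j) = 0" for t :: real
  proof -
    have "(\<Sum>j\<le>m. t ^ j *\<^sub>R d j) = (\<Sum>j\<le>Suc m. t ^ j *\<^sub>R d j)"
      by (simp add: d_def)
    also have "\<dots> = (\<Sum>j\<le>Suc m. (2 * t) ^ j *\<^sub>R c j) - 2 ^ Suc m *\<^sub>R (\<Sum>j\<le>Suc m. t ^ j *\<^sub>R c j)"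
      unfolding scaleR_sum_right sum_subtractf[symmetric]
      by (intro sum.cong refl) (simp add: d_def power_mult_distrib algebra_simps)
    also have "\<dots> = 0"
      by (simp only: Suc.prems(1) scaleR_zero_right diff_zero)
    finally show ?thesis .
  qed
  have lower: "c j = 0" if "j \<le> m" for j
  proof -
    have "d j = 0" by (rule Suc.IH[OF d_sum that])
    moreover have "(2::real) ^ j \<noteq> 2 ^ Suc m"
      using that power_strict_increasing[of j "Suc m" "2::real"] by linarith
    ultimately show ?thesis by (simp add: d_def)
  qed
  moreover have "c (Suc m) = 0"
    using Suc.prems(1)[of 1] lower by simp
  ultimately show ?case
    using Suc.prems(2) by (auto simp: le_Suc_eq)
qed

text \<open>
  Comparing all coefficients of the polarised identity, and not only those of \<open>t\<close>, gives every
  smaller exponent at once: exponent \<open>k\<close> comes from the coefficient of \<open>t\<^bsup>m - k\<^esup>\<close>.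
\<close>

lemma jordan_coefficient_downward:
  fixes \<phi> :: "'a::complex_unital_banach_algebra \<Rightarrow> 'b::complex_unital_banach_algebra"
  assumes "right_module act" and "clinear \<phi>" and unital: "\<phi> 1 = 1"
    and jordan: "jordan_coefficient act m \<phi> w" and "k \<le> m"
  shows "jordan_coefficient act k \<phi> w"
  unfolding jordan_coefficient_def
proof
  fix a
  interpret \<phi>: linear \<phi> by (rule clinear_imp_linear) fact
  interpret act: linear "\<lambda>b. act b w"
    by (rule clinear_imp_linear) (rule right_module.act_linear_left, fact)
  define c where
    "c j = real (m choose j) *\<^sub>R (\<phi> (a ^ (m - j) * w) - act (\<phi> a ^ (m - j)) w)" for j
  have "(\<Sum>j\<le>m. t ^ j *\<^sub>R c j) = 0" for t :: real
  proof -
    have "(\<Sum>j\<le>m. t ^ j *\<^sub>R c j) =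
        \<phi> ((a + t *\<^sub>R 1) ^ m * w) - act ((\<phi> a + t *\<^sub>R 1) ^ m) w"
      unfolding binomial_add_scaleR_one sum_distrib_right \<phi>.sum act.sum sum_subtractf[symmetric]
      by (intro sum.cong refl)
        (simp add: c_def \<phi>.scale act.scale scaleR_diff_right mult_ac)
    also have "\<phi> a + t *\<^sub>R 1 = \<phi> (a + t *\<^sub>R 1)"
      by (simp add: \<phi>.add \<phi>.scale unital)
    finally show ?thesis
      using jordan by (simp add: jordan_coefficient_def)
  qed
  then have "c (m - k) = 0"
    by (rule vector_polynomial_eq_0_imp_coeffs_eq_0) simp
  then show "\<phi> (a ^ k * w) = act (\<phi> a ^ k) w"
    using \<open>k \<le> m\<close> diff_le_self[of m k] by (auto simp: c_def not_less[symmetric])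
qed

theorem theorem3p4:
  fixes n :: nat
    and act :: "'b::complex_unital_banach_algebra \<Rightarrow> 'a::complex_unital_banach_algebra \<Rightarrow> 'b"
    and \<phi> :: "'a \<Rightarrow> 'b"
    and w :: 'a
  assumes "n > 0"
    and "right_module act"
    and "pseudo_jordan_homomorphism act (n + 1) \<phi>"
    and "jordan_coefficient act (n + 1) \<phi> w"
    and "\<phi> 1 = 1"
  shows "pseudo_jordan_homomorphism act n \<phi> \<and> jordan_coefficient act n \<phi> w"
proof -
  have "clinear \<phi>"
    using assms(3) by (simp add: pseudo_jordan_homomorphism_def)
  moreover from this have "jordan_coefficient act n \<phi> w"
    using assms(2,4,5) by (auto intro: jordan_coefficient_downward)
  ultimately show ?thesis
    by (auto simp: pseudo_jordan_homomorphism_def)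
qed

end
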